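(* Let $\mathcal C_i$ ($i\in I$), $\mathcal C$, $\mathcal D$ be categories with orthogonal factorization systems $(E_i',M_i')$ ($i\in I$), $(E',M')$, $(E'',M'')$, respectively. Let $F,G\colon\mathcal C\to\mathcal D$ be functors preserving the left and right classes, respectively, i.e. $F(E')\subseteq E''$ and $G(M')\subseteq M''$. Then: 1. $(\prod_iE_i',\prod_iM_i')$ is the unique orthogonal factorization system on $\prod_i\mathcal C_i$ preserved by the projections. 2. $(U^{-1}(E'),U^{-1}(M'))$ is the unique orthogonal factorization system on the inserter category $\mathrm{Ins}(F,G)$ preserved by the forgetful functor $U\colon\mathrm{Ins}(F,G)\to\mathcal C$. 3. Let $\eta,\theta\colon F\Rightarrow G$ be natural transformations. Then the equifier category $\mathrm{Eq}(\eta,\theta)$ has a unique orthogonal factorization system preserved by the forgetful functor $U\colon\mathrm{Eq}(\eta,\theta)\to\mathcal C$, namely $(U^{-1}(E'),U^{-1}(M'))$.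
   Context: For morphisms $e\colon a\to b$ and $m\colon c\to d$ of a category, $e\perp m$ means: for all $f\colon a\to c$, $g\colon b\to d$ with $mf=ge$ there is a unique $h\colon b\to c$ with $he=f$ and $mh=g$. For a class $A$ of morphisms, $A^\perp$ is the class of $m$ with $a\perp m$ for all $a\in A$, and ${}^\perp A$ is the class of $e$ with $e\perp a$ for all $a\in A$. An orthogonal factorization system on $\mathcal C$ is a pair $(E,M)$ of classes of morphisms such that every morphism factors as $m\circ e$ with $e\in E$, $m\in M$, and $M=E^\perp$, $E={}^\perp M$; $E$ is the left class and $M$ the right class. A functor preserves orthogonal factorization systems if it sends the left class into the left class and the right class into the right class. $\prod_iE_i'$ is the class of morphisms $(f_i)_i$ of $\prod_i\mathcal C_i$ with all $f_i\in E_i'$; similarly $\prod_iM_i'$. The inserter category $\mathrm{Ins}(F,G)$ has as objects pairs $(c,\phi\colon Fc\to Gc)$ and as morphisms $(c,\phi)\to(d,\psi)$ the morphisms $f\colon c\to d$ of $\mathcal C$ with $G(f)\phi=\psi F(f)$; $U$ forgets $\phi$. The equifier category $\mathrm{Eq}(\eta,\theta)$ is the full subcategory of $\mathcal C$ on the objects $c$ with $\eta_c=\theta_c$; $U$ is the inclusion. $U^{-1}(E')$ is the class of morphisms $f$ with $U(f)\in E'$. *)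

theory Defs
  imports "HOL-Library.FuncSet"
begin

section \<open>Categories, functors, natural transformations\<close>

record ('o, 'a) cat =
  Obj :: "'o set"
  Arr :: "'a set"
  Dom :: "'a \<Rightarrow> 'o"
  Cod :: "'a \<Rightarrow> 'o"
  Ident :: "'o \<Rightarrow> 'a"
  Comp :: "'a \<Rightarrow> 'a \<Rightarrow> 'a"  (infixl "\<cdot>\<index>" 70)

text \<open>Composition is written in applicative order: \<open>g \<cdot>\<^bsub>C\<^esub> f\<close> is ``first f, then g'';
  its value is only meaningful when \<open>Cod C f = Dom C g\<close>.\<close>

definition hom :: "('o, 'a, 'x) cat_scheme \<Rightarrow> 'o \<Rightarrow> 'o \<Rightarrow> 'a set" where
  "hom C a b = {f \<in> Arr C. Dom C f = a \<and> Cod C f = b}"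

locale category =
  fixes C :: "('o, 'a) cat" (structure)
  assumes Dom_in_Obj: "f \<in> Arr C \<Longrightarrow> Dom C f \<in> Obj C"
    and Cod_in_Obj: "f \<in> Arr C \<Longrightarrow> Cod C f \<in> Obj C"
    and Ident_in_hom: "a \<in> Obj C \<Longrightarrow> Ident C a \<in> hom C a a"
    and Comp_in_hom: "f \<in> hom C a b \<Longrightarrow> g \<in> hom C b c \<Longrightarrow> g \<cdot> f \<in> hom C a c"
    and Comp_Ident: "f \<in> hom C a b \<Longrightarrow> f \<cdot> Ident C a = f"
    and Ident_Comp: "f \<in> hom C a b \<Longrightarrow> Ident C b \<cdot> f = f"
    and Comp_assoc: "f \<in> hom C a b \<Longrightarrow> g \<in> hom C b c \<Longrightarrow> h \<in> hom C c d \<Longrightarrow>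
      (h \<cdot> g) \<cdot> f = h \<cdot> (g \<cdot> f)"

record ('o1, 'a1, 'o2, 'a2) func =
  obj_map :: "'o1 \<Rightarrow> 'o2"
  arr_map :: "'a1 \<Rightarrow> 'a2"

locale cat_functor = C: category C + D: category D
  for C :: "('o1, 'a1) cat" and D :: "('o2, 'a2) cat" +
  fixes F :: "('o1, 'a1, 'o2, 'a2) func"
  assumes obj_map_Obj: "a \<in> Obj C \<Longrightarrow> obj_map F a \<in> Obj D"
    and arr_map_hom: "f \<in> hom C a b \<Longrightarrow> arr_map F f \<in> hom D (obj_map F a) (obj_map F b)"
    and arr_map_Ident: "a \<in> Obj C \<Longrightarrow> arr_map F (Ident C a) = Ident D (obj_map F a)"
    and arr_map_Comp: "f \<in> hom C a b \<Longrightarrow> g \<in> hom C b c \<Longrightarrow>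
      arr_map F (g \<cdot>\<^bsub>C\<^esub> f) = arr_map F g \<cdot>\<^bsub>D\<^esub> arr_map F f"

locale nat_transformation = F: cat_functor C D F + G: cat_functor C D G
  for C :: "('o1, 'a1) cat" and D :: "('o2, 'a2) cat"
    and F :: "('o1, 'a1, 'o2, 'a2) func" and G :: "('o1, 'a1, 'o2, 'a2) func" +
  fixes \<eta> :: "'o1 \<Rightarrow> 'a2"
  assumes component_hom: "c \<in> Obj C \<Longrightarrow> \<eta> c \<in> hom D (obj_map F c) (obj_map G c)"
    and naturality: "f \<in> hom C c d \<Longrightarrow> arr_map G f \<cdot>\<^bsub>D\<^esub> \<eta> c = \<eta> d \<cdot>\<^bsub>D\<^esub> arr_map F f"


section \<open>Orthogonal factorization systems\<close>

definition orthogonal :: "('o, 'a) cat \<Rightarrow> 'a \<Rightarrow> 'a \<Rightarrow> bool" where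
  "orthogonal C e m \<longleftrightarrow>
    (\<forall>f \<in> hom C (Dom C e) (Dom C m). \<forall>g \<in> hom C (Cod C e) (Cod C m).
      m \<cdot>\<^bsub>C\<^esub> f = g \<cdot>\<^bsub>C\<^esub> e \<longrightarrow>
      (\<exists>!h. h \<in> hom C (Cod C e) (Dom C m) \<and> h \<cdot>\<^bsub>C\<^esub> e = f \<and> m \<cdot>\<^bsub>C\<^esub> h = g))"

definition right_orth :: "('o, 'a) cat \<Rightarrow> 'a set \<Rightarrow> 'a set" where
  "right_orth C A = {m \<in> Arr C. \<forall>a\<in>A. orthogonal C a m}"

definition left_orth :: "('o, 'a) cat \<Rightarrow> 'a set \<Rightarrow> 'a set" where
  "left_orth C A = {e \<in> Arr C. \<forall>a\<in>A. orthogonal C e a}"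

text \<open>The last two assumptions force \<open>E\<close> and \<open>M\<close> to consist of arrows of \<open>C\<close>.\<close>

locale orth_fact_system = category C for C :: "('o, 'a) cat" (structure) +
  fixes E M :: "'a set"
  assumes factorization: "f \<in> Arr C \<Longrightarrow> \<exists>e\<in>E. \<exists>m\<in>M. Cod C e = Dom C m \<and> f = m \<cdot> e"
    and right_class: "M = right_orth C E"
    and left_class: "E = left_orth C M"

locale ofs_preserving_functor = cat_functor C D F
  for C :: "('o1, 'a1) cat" and E M :: "'a1 set"
    and D :: "('o2, 'a2) cat" and E' M' :: "'a2 set"
    and F :: "('o1, 'a1, 'o2, 'a2) func" +
  assumes preserves_left: "arr_map F ` E \<subseteq> E'"
    and preserves_right: "arr_map F ` M \<subseteq> M'"

definition preimage_class ::
    "('o1, 'a1) cat \<Rightarrow> ('o1, 'a1, 'o2, 'a2) func \<Rightarrow> 'a2 set \<Rightarrow> 'a1 set" where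
  "preimage_class C U E = {f \<in> Arr C. arr_map U f \<in> E}"


section \<open>Products\<close>

text \<open>Families \<open>(x\<^sub>i)\<close> indexed by a set \<open>I\<close> are represented by functions that are
  \<open>undefined\<close> outside \<open>I\<close>, so that distinct functions are distinct families.\<close>

definition product_cat :: "'i set \<Rightarrow> ('i \<Rightarrow> ('o, 'a) cat) \<Rightarrow> ('i \<Rightarrow> 'o, 'i \<Rightarrow> 'a) cat" where
  "product_cat I C = \<lparr>
     Obj = (\<Pi>\<^sub>E i\<in>I. Obj (C i)),
     Arr = (\<Pi>\<^sub>E i\<in>I. Arr (C i)),
     Dom = (\<lambda>f. \<lambda>i\<in>I. Dom (C i) (f i)),
     Cod = (\<lambda>f. \<lambda>i\<in>I. Cod (C i) (f i)),
     Ident = (\<lambda>x. \<lambda>i\<in>I. Ident (C i) (x i)),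
     Comp = (\<lambda>g f. \<lambda>i\<in>I. g i \<cdot>\<^bsub>C i\<^esub> f i) \<rparr>"

definition projection :: "'i \<Rightarrow> ('i \<Rightarrow> 'o, 'i \<Rightarrow> 'a, 'o, 'a) func" where
  "projection i = \<lparr> obj_map = (\<lambda>x. x i), arr_map = (\<lambda>f. f i) \<rparr>"

definition product_class ::
    "'i set \<Rightarrow> ('i \<Rightarrow> ('o, 'a) cat) \<Rightarrow> ('i \<Rightarrow> 'a set) \<Rightarrow> ('i \<Rightarrow> 'a) set" where
  "product_class I C E = {f \<in> Arr (product_cat I C). \<forall>i\<in>I. f i \<in> E i}"


section \<open>Inserters\<close>

text \<open>The same arrow \<open>f\<close> of \<open>C\<close> may underlie morphisms between different pairs of objects
  \<open>(c, \<phi>)\<close>, \<open>(d, \<psi>)\<close>; arrows of the inserter therefore carry their domain and codomain: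
  they are triples \<open>((c, \<phi>), f, (d, \<psi>))\<close>.\<close>

definition inserter_obj ::
    "('o1, 'a1) cat \<Rightarrow> ('o2, 'a2) cat \<Rightarrow> ('o1, 'a1, 'o2, 'a2) func \<Rightarrow> ('o1, 'a1, 'o2, 'a2) func
      \<Rightarrow> ('o1 \<times> 'a2) set" where
  "inserter_obj C D F G = {(c, \<phi>). c \<in> Obj C \<and> \<phi> \<in> hom D (obj_map F c) (obj_map G c)}"

definition inserter ::
    "('o1, 'a1) cat \<Rightarrow> ('o2, 'a2) cat \<Rightarrow> ('o1, 'a1, 'o2, 'a2) func \<Rightarrow> ('o1, 'a1, 'o2, 'a2) func
      \<Rightarrow> ('o1 \<times> 'a2, ('o1 \<times> 'a2) \<times> 'a1 \<times> ('o1 \<times> 'a2)) cat" where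
  "inserter C D F G = \<lparr>
     Obj = inserter_obj C D F G,
     Arr = {((c, \<phi>), f, (d, \<psi>)) | c \<phi> f d \<psi>.
       (c, \<phi>) \<in> inserter_obj C D F G \<and> (d, \<psi>) \<in> inserter_obj C D F G \<and>
       f \<in> hom C c d \<and> arr_map G f \<cdot>\<^bsub>D\<^esub> \<phi> = \<psi> \<cdot>\<^bsub>D\<^esub> arr_map F f},
     Dom = (\<lambda>(x, f, y). x),
     Cod = (\<lambda>(x, f, y). y),
     Ident = (\<lambda>x. (x, Ident C (fst x), x)),
     Comp = (\<lambda>(y', g, z) (x, f, y). (x, g \<cdot>\<^bsub>C\<^esub> f, z)) \<rparr>"

definition inserter_forget ::
    "('o1 \<times> 'a2, ('o1 \<times> 'a2) \<times> 'a1 \<times> ('o1 \<times> 'a2), 'o1, 'a1) func" where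
  "inserter_forget = \<lparr> obj_map = fst, arr_map = (\<lambda>(x, f, y). f) \<rparr>"


section \<open>Equifiers\<close>

definition full_subcat :: "('o, 'a) cat \<Rightarrow> 'o set \<Rightarrow> ('o, 'a) cat" where
  "full_subcat C S = C \<lparr>
     Obj := Obj C \<inter> S,
     Arr := {f \<in> Arr C. Dom C f \<in> S \<and> Cod C f \<in> S} \<rparr>"

definition equifier :: "('o1, 'a1) cat \<Rightarrow> ('o1 \<Rightarrow> 'a2) \<Rightarrow> ('o1 \<Rightarrow> 'a2) \<Rightarrow> ('o1, 'a1) cat" where
  "equifier C \<eta> \<theta> = full_subcat C {c. \<eta> c = \<theta> c}"

definition inclusion :: "('o, 'a, 'o, 'a) func" where
  "inclusion = \<lparr> obj_map = (\<lambda>c. c), arr_map = (\<lambda>f. f) \<rparr>"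


section \<open>The constructions are categories with functors to their constituents\<close>

lemma category_product_cat:
  assumes "\<And>i. i \<in> I \<Longrightarrow> category (C i)"
  shows "category (product_cat I C)"
proof -
  have hom_iff: "f \<in> hom (product_cat I C) a b \<longleftrightarrow>
      a \<in> extensional I \<and> b \<in> extensional I \<and> f \<in> (\<Pi>\<^sub>E i\<in>I. hom (C i) (a i) (b i))" for f a b
    by (auto simp: hom_def product_cat_def PiE_iff extensional_def fun_eq_iff restrict_def)
  show ?thesis
  proof (unfold_locales, goal_cases)
    case (1 f) then show ?case
      by (auto simp: product_cat_def PiE_iff category.Dom_in_Obj[OF assms])
  next
    case (2 f) then show ?case
      by (auto simp: product_cat_def PiE_iff category.Cod_in_Obj[OF assms])
  next
    case (3 a) then show ?case unfolding hom_iff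
      by (auto simp: product_cat_def PiE_iff category.Ident_in_hom[OF assms])
  next
    case (4 f a b g c) then show ?case unfolding hom_iff
      by (auto simp: product_cat_def PiE_iff intro: category.Comp_in_hom[OF assms])
  next
    case (5 f a b) then show ?case unfolding hom_iff
      by (auto simp: product_cat_def PiE_iff extensional_def fun_eq_iff
          category.Comp_Ident[OF assms])
  next
    case (6 f a b) then show ?case unfolding hom_iff
      by (auto simp: product_cat_def PiE_iff extensional_def fun_eq_iff
          category.Ident_Comp[OF assms])
  next
    case (7 f a b g c h d) then show ?case unfolding hom_iff
      by (auto simp: product_cat_def PiE_iff fun_eq_iff restrict_def
          intro: category.Comp_assoc[OF assms])
  qed
qed

lemma cat_functor_projection:
  assumes "\<And>i. i \<in> I \<Longrightarrow> category (C i)" and "i \<in> I"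
  shows "cat_functor (product_cat I C) (C i) (projection i)"
proof -
  interpret P: category "product_cat I C" using assms(1) by (rule category_product_cat)
  interpret category "C i" using assms by blast
  show ?thesis
    by unfold_locales (use assms(2) in \<open>auto simp: hom_def product_cat_def projection_def\<close>)
qed

lemma category_inserter:
  assumes "cat_functor C D F" and "cat_functor C D G"
  shows "category (inserter C D F G)"
proof -
  interpret F: cat_functor C D F by fact
  interpret G: cat_functor C D G by fact
  have hom_iff: "t \<in> hom (inserter C D F G) x y \<longleftrightarrow>
      (\<exists>f. t = (x, f, y) \<and> x \<in> inserter_obj C D F G \<and> y \<in> inserter_obj C D F G \<and>
       f \<in> hom C (fst x) (fst y) \<and> arr_map G f \<cdot>\<^bsub>D\<^esub> snd x = snd y \<cdot>\<^bsub>D\<^esub> arr_map F f)" for t x y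
    by (cases x; cases y) (auto simp: hom_def inserter_def)
  have obj: "x \<in> inserter_obj C D F G \<longleftrightarrow>
      fst x \<in> Obj C \<and> snd x \<in> hom D (obj_map F (fst x)) (obj_map G (fst x))" for x
    by (cases x) (auto simp: inserter_obj_def)
  show ?thesis
  proof (unfold_locales, goal_cases)
    case (3 a) then show ?case unfolding hom_iff
      using F.D.Comp_Ident F.D.Ident_Comp
      by (auto simp: inserter_def obj F.C.Ident_in_hom F.arr_map_Ident G.arr_map_Ident)
  next
    case (4 f x y g z)
    then obtain f0 g0 where *: "f = (x, f0, y)" "g = (y, g0, z)"
      "f0 \<in> hom C (fst x) (fst y)" "g0 \<in> hom C (fst y) (fst z)"
      and sf: "arr_map G f0 \<cdot>\<^bsub>D\<^esub> snd x = snd y \<cdot>\<^bsub>D\<^esub> arr_map F f0"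
      and sg: "arr_map G g0 \<cdot>\<^bsub>D\<^esub> snd y = snd z \<cdot>\<^bsub>D\<^esub> arr_map F g0"
      and xyz: "x \<in> inserter_obj C D F G" "y \<in> inserter_obj C D F G" "z \<in> inserter_obj C D F G"
      unfolding hom_iff by blast
    note homs = F.arr_map_hom[OF *(3)] F.arr_map_hom[OF *(4)]
      G.arr_map_hom[OF *(3)] G.arr_map_hom[OF *(4)]
    have sx: "snd x \<in> hom D (obj_map F (fst x)) (obj_map G (fst x))"
      and sy: "snd y \<in> hom D (obj_map F (fst y)) (obj_map G (fst y))"
      and sz: "snd z \<in> hom D (obj_map F (fst z)) (obj_map G (fst z))"
      using xyz by (auto simp: obj)
    have "arr_map G (g0 \<cdot>\<^bsub>C\<^esub> f0) \<cdot>\<^bsub>D\<^esub> snd x = arr_map G g0 \<cdot>\<^bsub>D\<^esub> (arr_map G f0 \<cdot>\<^bsub>D\<^esub> snd x)"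
      by (simp add: G.arr_map_Comp[OF *(3,4)] F.D.Comp_assoc[OF sx homs(3,4)])
    also have "\<dots> = (arr_map G g0 \<cdot>\<^bsub>D\<^esub> snd y) \<cdot>\<^bsub>D\<^esub> arr_map F f0"
      by (simp add: sf F.D.Comp_assoc[OF homs(1) sy homs(4)])
    also have "\<dots> = snd z \<cdot>\<^bsub>D\<^esub> arr_map F (g0 \<cdot>\<^bsub>C\<^esub> f0)"
      by (simp add: sg F.arr_map_Comp[OF *(3,4)] F.D.Comp_assoc[OF homs(1,2) sz])
    finally show ?case unfolding hom_iff
      using * xyz F.C.Comp_in_hom[OF *(3,4)] by (auto simp: inserter_def)
  next
    case (7 f a b g c h d) then show ?case unfolding hom_iff
      by (auto simp: inserter_def intro: F.C.Comp_assoc)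
  qed (unfold hom_iff, auto simp: inserter_def F.C.Comp_Ident F.C.Ident_Comp)
qed

lemma cat_functor_inserter_forget:
  assumes "cat_functor C D F" and "cat_functor C D G"
  shows "cat_functor (inserter C D F G) C inserter_forget"
proof -
  interpret F: cat_functor C D F by fact
  interpret I: category "inserter C D F G" using assms by (rule category_inserter)
  show ?thesis
    by unfold_locales
      (auto simp: inserter_def inserter_obj_def inserter_forget_def hom_def)
qed

lemma category_full_subcat:
  assumes "category C"
  shows "category (full_subcat C S)"
proof -
  interpret category C by fact
  have hom_iff: "f \<in> hom (full_subcat C S) a b \<longleftrightarrow> a \<in> S \<and> b \<in> S \<and> f \<in> hom C a b" for f a b
    by (auto simp: hom_def full_subcat_def)
  show ?thesis
    by (unfold_locales; (unfold hom_iff)?)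
      (auto simp: full_subcat_def Dom_in_Obj Cod_in_Obj Ident_in_hom Comp_Ident Ident_Comp
        intro: Comp_in_hom Comp_assoc)
qed

lemma cat_functor_inclusion:
  assumes "category C"
  shows "cat_functor (full_subcat C S) C inclusion"
proof -
  interpret category C by fact
  interpret S: category "full_subcat C S" using assms by (rule category_full_subcat)
  show ?thesis
    by unfold_locales (auto simp: full_subcat_def inclusion_def hom_def)
qed

end

theory Submission imports Defs begin

text \<open>All three categories carry a family of functors to categories with factorization systems, and
  the candidate classes are the joint preimages. Two facts about such a pair of classes hold in
  general: if it factorizes every morphism and is orthogonal, then it is a factorization system,
  because a morphism \<open>m\<close> in the right orthogonal class has an invertible first factor and the classes
  downstairs are closed under isomorphisms; and it is the only preserved one, because a second one
  would be contained in it, while taking orthogonals reverses inclusions.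
  For inserters and equifiers, factorizations and diagonals are created by the forgetful functor:
  if \<open>e \<in> E'\<close> and \<open>m \<in> M'\<close>, then \<open>F e \<bottom> G m\<close>, whose unique diagonals supply
  the structure morphism on the middle object and the required equations.\<close>

section \<open>Hom-sets, orthogonality and unique diagonals\<close>

lemma homD:
  assumes "f \<in> hom C a b"
  shows "f \<in> Arr C" "Dom C f = a" "Cod C f = b"
  using assms by (auto simp: hom_def)

lemma Arr_in_hom: "f \<in> Arr C \<Longrightarrow> f \<in> hom C (Dom C f) (Cod C f)"
  by (simp add: hom_def)

lemma orthogonal_hom_iff:
  assumes "e \<in> hom C a b" "m \<in> hom C c d"
  shows "orthogonal C e m \<longleftrightarrow> (\<forall>f \<in> hom C a c. \<forall>g \<in> hom C b d. m \<cdot>\<^bsub>C\<^esub> f = g \<cdot>\<^bsub>C\<^esub> e \<longrightarrow>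
    (\<exists>!h. h \<in> hom C b c \<and> h \<cdot>\<^bsub>C\<^esub> e = f \<and> m \<cdot>\<^bsub>C\<^esub> h = g))"
  unfolding orthogonal_def homD(2,3)[OF assms(1)] homD(2,3)[OF assms(2)] ..

lemma orthogonal_lift:
  assumes "orthogonal C e m" "e \<in> hom C a b" "m \<in> hom C c d"
    and "f \<in> hom C a c" "g \<in> hom C b d" "m \<cdot>\<^bsub>C\<^esub> f = g \<cdot>\<^bsub>C\<^esub> e"
  obtains h where "h \<in> hom C b c" "h \<cdot>\<^bsub>C\<^esub> e = f" "m \<cdot>\<^bsub>C\<^esub> h = g"
  using assms(1)[unfolded orthogonal_hom_iff[OF assms(2,3)]] assms(4-6) by blast

context category
begin

lemma Comp_Arr: "f \<in> Arr C \<Longrightarrow> g \<in> Arr C \<Longrightarrow> Cod C f = Dom C g \<Longrightarrow> g \<cdot> f \<in> hom C (Dom C f) (Cod C g)"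
  by (rule Comp_in_hom) (auto simp: hom_def)

text \<open>Both arrows fill the square with top \<open>h \<cdot> e\<close> and bottom
  \<open>m \<cdot> h\<close>, which commutes by associativity. In this form uniqueness proves
  equations between arrows without a square being given in advance.\<close>

lemma orthogonal_lift_unique:
  assumes orth: "orthogonal C e m" and e: "e \<in> hom C a b" and m: "m \<in> hom C c d"
    and h: "h \<in> hom C b c" and k: "k \<in> hom C b c"
    and eqs: "h \<cdot> e = k \<cdot> e" "m \<cdot> h = m \<cdot> k"
  shows "h = k"
proof -
  have "\<exists>!l. l \<in> hom C b c \<and> l \<cdot> e = h \<cdot> e \<and> m \<cdot> l = m \<cdot> h"
    using orth[unfolded orthogonal_hom_iff[OF e m]] Comp_in_hom[OF e h] Comp_in_hom[OF h m]
      Comp_assoc[OF e h m] by metis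
  then show ?thesis using h k eqs by metis
qed

text \<open>Separates the unique diagonal into existence for each commuting square and joint
  cancellation of \<open>e\<close> and \<open>m\<close>; the second part mentions no square.\<close>

lemma orthogonalI:
  assumes e: "e \<in> hom C a b" and m: "m \<in> hom C c d"
    and ex: "\<And>f g. f \<in> hom C a c \<Longrightarrow> g \<in> hom C b d \<Longrightarrow> m \<cdot> f = g \<cdot> e \<Longrightarrow>
      \<exists>h \<in> hom C b c. h \<cdot> e = f \<and> m \<cdot> h = g"
    and uniq: "\<And>h k. h \<in> hom C b c \<Longrightarrow> k \<in> hom C b c \<Longrightarrow> h \<cdot> e = k \<cdot> e \<Longrightarrow> m \<cdot> h = m \<cdot> k \<Longrightarrow> h = k"
  shows "orthogonal C e m"
  unfolding orthogonal_hom_iff[OF e m] using ex uniq by metis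

text \<open>A square against \<open>m \<cdot> i\<close> becomes one against \<open>m\<close> when
  its top is composed with \<open>i\<close>, and \<open>j\<close> carries the diagonal back. For
  uniqueness, \<open>i\<close> can be cancelled on the left because \<open>j\<close> inverts
  it.\<close>

lemma orthogonal_comp_iso_right:
  assumes orth: "orthogonal C e m" and e: "e \<in> hom C a b" and m: "m \<in> hom C c d"
    and i: "i \<in> hom C c' c" and j: "j \<in> hom C c c'"
    and ji: "j \<cdot> i = Ident C c'" and ij: "i \<cdot> j = Ident C c"
  shows "orthogonal C e (m \<cdot> i)"
proof (rule orthogonalI[OF e Comp_in_hom[OF i m]])
  fix f g assume f: "f \<in> hom C a c'" and g: "g \<in> hom C b d" and sq: "(m \<cdot> i) \<cdot> f = g \<cdot> e"
  obtain h where h: "h \<in> hom C b c" "h \<cdot> e = i \<cdot> f" "m \<cdot> h = g"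
    using orthogonal_lift[OF orth e m Comp_in_hom[OF f i] g] sq Comp_assoc[OF f i m] by metis
  have "(j \<cdot> h) \<cdot> e = f"
    using Comp_assoc[OF e h(1) j] h(2) Comp_assoc[OF f i j] ji Ident_Comp[OF f] by simp
  moreover have "(m \<cdot> i) \<cdot> (j \<cdot> h) = g"
    using Comp_assoc[OF Comp_in_hom[OF h(1) j] i m] Comp_assoc[OF h(1) j i] ij
      Ident_Comp[OF h(1)] h(3) by simp
  ultimately show "\<exists>h \<in> hom C b c'. h \<cdot> e = f \<and> (m \<cdot> i) \<cdot> h = g"
    using Comp_in_hom[OF h(1) j] by blast
next
  fix h k assume h: "h \<in> hom C b c'" and k: "k \<in> hom C b c'"
    and eqs: "h \<cdot> e = k \<cdot> e" "(m \<cdot> i) \<cdot> h = (m \<cdot> i) \<cdot> k"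
  have "i \<cdot> h = i \<cdot> k"
    using orthogonal_lift_unique[OF orth e m Comp_in_hom[OF h i] Comp_in_hom[OF k i]] eqs
      Comp_assoc[OF e h i] Comp_assoc[OF e k i] Comp_assoc[OF h i m] Comp_assoc[OF k i m] by simp
  then have "j \<cdot> (i \<cdot> h) = j \<cdot> (i \<cdot> k)" by simp
  then show "h = k"
    using Comp_assoc[OF h i j] Comp_assoc[OF k i j] ji Ident_Comp[OF h] Ident_Comp[OF k] by metis
qed

text \<open>Dually, the bottom of the square is precomposed with \<open>i\<close>, and the diagonal
  is precomposed with \<open>j\<close>.\<close>

lemma orthogonal_comp_iso_left:
  assumes orth: "orthogonal C e m" and e: "e \<in> hom C a b" and m: "m \<in> hom C c d"
    and i: "i \<in> hom C b b'" and j: "j \<in> hom C b' b"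
    and ji: "j \<cdot> i = Ident C b" and ij: "i \<cdot> j = Ident C b'"
  shows "orthogonal C (i \<cdot> e) m"
proof (rule orthogonalI[OF Comp_in_hom[OF e i] m])
  fix f g assume f: "f \<in> hom C a c" and g: "g \<in> hom C b' d" and sq: "m \<cdot> f = g \<cdot> (i \<cdot> e)"
  obtain h where h: "h \<in> hom C b c" "h \<cdot> e = f" "m \<cdot> h = g \<cdot> i"
    using orthogonal_lift[OF orth e m f Comp_in_hom[OF i g]] sq Comp_assoc[OF e i g] by metis
  have "m \<cdot> (h \<cdot> j) = g"
    using Comp_assoc[OF j h(1) m] h(3) Comp_assoc[OF j i g] ij Comp_Ident[OF g] by simp
  moreover have "(h \<cdot> j) \<cdot> (i \<cdot> e) = f"
    using Comp_assoc[OF Comp_in_hom[OF e i] j h(1)] Comp_assoc[OF e i j] ji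
      Ident_Comp[OF e] h(2) by simp
  ultimately show "\<exists>h \<in> hom C b' c. h \<cdot> (i \<cdot> e) = f \<and> m \<cdot> h = g"
    using Comp_in_hom[OF j h(1)] by blast
next
  fix h k assume h: "h \<in> hom C b' c" and k: "k \<in> hom C b' c"
    and eqs: "h \<cdot> (i \<cdot> e) = k \<cdot> (i \<cdot> e)" "m \<cdot> h = m \<cdot> k"
  have "h \<cdot> i = k \<cdot> i"
    using orthogonal_lift_unique[OF orth e m Comp_in_hom[OF i h] Comp_in_hom[OF i k]] eqs
      Comp_assoc[OF e i h] Comp_assoc[OF e i k] Comp_assoc[OF i h m] Comp_assoc[OF i k m] by simp
  then have "(h \<cdot> i) \<cdot> j = (k \<cdot> i) \<cdot> j" by simp
  then show "h = k"
    using Comp_assoc[OF j i h] Comp_assoc[OF j i k] ij Comp_Ident[OF h] Comp_Ident[OF k] by metis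
qed

section \<open>Recognizing and comparing factorization systems\<close>

text \<open>Closure under isomorphisms is asked for on one side only: if
  \<open>f = m \<cdot> e\<close> is right orthogonal to \<open>E\<close>, then \<open>e\<close> is
  invertible and \<open>f\<close> is \<open>m\<close> precomposed with it; if \<open>f\<close> is
  left orthogonal to \<open>M\<close>, then \<open>m\<close> is invertible and \<open>f\<close> is
  \<open>e\<close> followed by it.\<close>

lemma orth_fact_systemI:
  assumes E: "E \<subseteq> Arr C" and M: "M \<subseteq> Arr C"
    and fact: "\<And>f. f \<in> Arr C \<Longrightarrow> \<exists>e\<in>E. \<exists>m\<in>M. Cod C e = Dom C m \<and> f = m \<cdot> e"
    and orth: "\<And>e m. e \<in> E \<Longrightarrow> m \<in> M \<Longrightarrow> orthogonal C e m"
    and iso_E: "\<And>e a b b' i j. e \<in> E \<Longrightarrow> e \<in> hom C a b \<Longrightarrow> i \<in> hom C b b' \<Longrightarrow> j \<in> hom C b' b \<Longrightarrow>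
      j \<cdot> i = Ident C b \<Longrightarrow> i \<cdot> j = Ident C b' \<Longrightarrow> i \<cdot> e \<in> E"
    and iso_M: "\<And>m c c' d i j. m \<in> M \<Longrightarrow> m \<in> hom C c d \<Longrightarrow> i \<in> hom C c' c \<Longrightarrow> j \<in> hom C c c' \<Longrightarrow>
      j \<cdot> i = Ident C c' \<Longrightarrow> i \<cdot> j = Ident C c \<Longrightarrow> m \<cdot> i \<in> M"
  shows "orth_fact_system C E M"
proof
  show "M = right_orth C E"
  proof
    show "M \<subseteq> right_orth C E" using M orth by (auto simp: right_orth_def)
    show "right_orth C E \<subseteq> M"
    proof
      fix f assume "f \<in> right_orth C E"
      then have "f \<in> Arr C" and f_orth: "\<And>e. e \<in> E \<Longrightarrow> orthogonal C e f"
        by (auto simp: right_orth_def)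
      from fact[OF this(1)] obtain e m where em: "e \<in> E" "m \<in> M" "Cod C e = Dom C m" "f = m \<cdot> e"
        by blast
      obtain a b d where e: "e \<in> hom C a b" and m: "m \<in> hom C b d"
        using em E M Arr_in_hom by (metis subsetD)
      have f: "f \<in> hom C a d" using Comp_in_hom[OF e m] em(4) by simp
      have a: "a \<in> Obj C" and b: "b \<in> Obj C"
        using e Dom_in_Obj Cod_in_Obj by (auto simp: hom_def)
      \<comment> \<open>The square has \<open>e\<close> on the left, \<open>f\<close> on the right,
        an identity on top and \<open>m\<close> at the bottom; its diagonal is a left inverse of
        \<open>e\<close>.\<close>
      obtain h where h: "h \<in> hom C b a" "h \<cdot> e = Ident C a" "f \<cdot> h = m"
        using orthogonal_lift[OF f_orth[OF em(1)] e f Ident_in_hom[OF a] m] em(4) Comp_Ident[OF f]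
        by metis
      \<comment> \<open>Both sides are diagonals of the square from \<open>e\<close> to
        \<open>m\<close> with top \<open>e\<close> and bottom \<open>m\<close>.\<close>
      have "e \<cdot> h = Ident C b"
        using orthogonal_lift_unique[OF orth[OF em(1,2)] e m Comp_in_hom[OF h(1) e] Ident_in_hom[OF b]]
          Comp_assoc[OF e h(1) e] Comp_assoc[OF h(1) e m] h(2,3) em(4)
          Comp_Ident[OF e] Ident_Comp[OF e] Comp_Ident[OF m] by simp
      then show "f \<in> M" using iso_M[OF em(2) m e h(1,2)] em(4) by simp
    qed
  qed
  show "E = left_orth C M"
  proof
    show "E \<subseteq> left_orth C M" using E orth by (auto simp: left_orth_def)
    show "left_orth C M \<subseteq> E"
    proof
      fix f assume "f \<in> left_orth C M"
      then have "f \<in> Arr C" and f_orth: "\<And>m. m \<in> M \<Longrightarrow> orthogonal C f m"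
        by (auto simp: left_orth_def)
      from fact[OF this(1)] obtain e m where em: "e \<in> E" "m \<in> M" "Cod C e = Dom C m" "f = m \<cdot> e"
        by blast
      obtain a b d where e: "e \<in> hom C a b" and m: "m \<in> hom C b d"
        using em E M Arr_in_hom by (metis subsetD)
      have f: "f \<in> hom C a d" using Comp_in_hom[OF e m] em(4) by simp
      have d: "d \<in> Obj C" and b: "b \<in> Obj C"
        using m Dom_in_Obj Cod_in_Obj by (auto simp: hom_def)
      \<comment> \<open>Here \<open>f\<close> is on the left, \<open>m\<close> on the right,
        \<open>e\<close> on top and an identity at the bottom, so the diagonal is a right inverse of
        \<open>m\<close>.\<close>
      obtain h where h: "h \<in> hom C d b" "h \<cdot> f = e" "m \<cdot> h = Ident C d"
        using orthogonal_lift[OF f_orth[OF em(2)] f m e Ident_in_hom[OF d]] em(4) Ident_Comp[OF f]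
        by metis
      have "h \<cdot> m = Ident C b"
        using orthogonal_lift_unique[OF orth[OF em(1,2)] e m Comp_in_hom[OF m h(1)] Ident_in_hom[OF b]]
          Comp_assoc[OF e m h(1)] Comp_assoc[OF m h(1) m] h(2,3) em(4)
          Ident_Comp[OF e] Ident_Comp[OF m] Comp_Ident[OF m] by simp
      then show "f \<in> E" using iso_E[OF em(1) e m h(1) _ h(3)] em(4) by simp
    qed
  qed
qed (rule fact)

end

context orth_fact_system
begin

lemma left_Arr: "e \<in> E \<Longrightarrow> e \<in> Arr C"
  using left_class by (auto simp: left_orth_def)

lemma right_Arr: "m \<in> M \<Longrightarrow> m \<in> Arr C"
  using right_class by (auto simp: right_orth_def)

lemma orthogonal: "e \<in> E \<Longrightarrow> m \<in> M \<Longrightarrow> orthogonal C e m"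
  using right_class by (auto simp: right_orth_def)

text \<open>Membership in the left class is tested by orthogonality to \<open>M\<close>, which
  survives composition with an isomorphism. Together with its dual below, this yields the closure
  needed by \<open>orth_fact_systemI\<close> for classes defined as preimages.\<close>

lemma left_comp_iso:
  assumes "e \<in> E" "e \<in> hom C a b" "i \<in> hom C b b'" "j \<in> hom C b' b"
    and "j \<cdot> i = Ident C b" "i \<cdot> j = Ident C b'"
  shows "i \<cdot> e \<in> E"
proof -
  have "orthogonal C (i \<cdot> e) m" if "m \<in> M" for m
    by (rule orthogonal_comp_iso_left[OF orthogonal[OF assms(1) that] assms(2)
          Arr_in_hom[OF right_Arr[OF that]] assms(3-6)])
  then have "i \<cdot> e \<in> left_orth C M"
    using Comp_in_hom[OF assms(2,3)] by (simp add: left_orth_def homD(1))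
  then show ?thesis by (simp flip: left_class)
qed

lemma right_comp_iso:
  assumes "m \<in> M" "m \<in> hom C c d" "i \<in> hom C c' c" "j \<in> hom C c c'"
    and "j \<cdot> i = Ident C c'" "i \<cdot> j = Ident C c"
  shows "m \<cdot> i \<in> M"
proof -
  have "orthogonal C e (m \<cdot> i)" if "e \<in> E" for e
    by (rule orthogonal_comp_iso_right[OF orthogonal[OF that assms(1)]
          Arr_in_hom[OF left_Arr[OF that]] assms(2-6)])
  then have "m \<cdot> i \<in> right_orth C E"
    using Comp_in_hom[OF assms(3,2)] by (simp add: right_orth_def homD(1))
  then show ?thesis by (simp flip: right_class)
qed

text \<open>An arrow of \<open>E2\<close> is orthogonal to \<open>M2\<close>, hence to the smaller
  \<open>M\<close>, and so lies in \<open>E\<close>; dually for \<open>M2\<close>.\<close>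

lemma classes_eqI:
  assumes "orth_fact_system C E2 M2" and "E \<subseteq> E2" and "M \<subseteq> M2"
  shows "E = E2 \<and> M = M2"
proof -
  interpret S: orth_fact_system C E2 M2 by fact
  have "E2 \<subseteq> E" using assms(3) S.left_Arr S.orthogonal left_class by (auto simp: left_orth_def)
  moreover have "M2 \<subseteq> M"
    using assms(2) S.right_Arr S.orthogonal right_class by (auto simp: right_orth_def)
  ultimately show ?thesis using assms by blast
qed

end

section \<open>Factorization systems given by joint preimages\<close>

text \<open>Stated for a family of functors so that it covers both the projections of a product and
  a single forgetful functor. What remains for each construction is to factorize arrows and to fill
  squares.\<close>

lemma joint_preimage_ofs_unique:
  fixes U :: "'i \<Rightarrow> ('o1, 'a1, 'o2, 'a2) func" and Es Ms :: "'i \<Rightarrow> 'a2 set"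
  assumes A: "category A"
    and U: "\<And>i. i \<in> I \<Longrightarrow> cat_functor A (Cs i) (U i)"
    and S: "\<And>i. i \<in> I \<Longrightarrow> orth_fact_system (Cs i) (Es i) (Ms i)"
    and EA: "EA = {f \<in> Arr A. \<forall>i\<in>I. arr_map (U i) f \<in> Es i}"
    and MA: "MA = {f \<in> Arr A. \<forall>i\<in>I. arr_map (U i) f \<in> Ms i}"
    and fact: "\<And>f. f \<in> Arr A \<Longrightarrow> \<exists>e\<in>EA. \<exists>m\<in>MA. Cod A e = Dom A m \<and> f = m \<cdot>\<^bsub>A\<^esub> e"
    and orth: "\<And>e m. e \<in> EA \<Longrightarrow> m \<in> MA \<Longrightarrow> orthogonal A e m"
  shows "orth_fact_system A E M \<and>
      (\<forall>i\<in>I. ofs_preserving_functor A E M (Cs i) (Es i) (Ms i) (U i))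
    \<longleftrightarrow> E = EA \<and> M = MA" (is "?L \<longleftrightarrow> ?R")
proof -
  interpret category A by fact
  have ofs: "orth_fact_system A EA MA"
  proof (rule orth_fact_systemI[OF _ _ fact orth])
    fix e a b b' i j
    assume e: "e \<in> EA" "e \<in> hom A a b" and i: "i \<in> hom A b b'" and j: "j \<in> hom A b' b"
      and ij: "j \<cdot>\<^bsub>A\<^esub> i = Ident A b" "i \<cdot>\<^bsub>A\<^esub> j = Ident A b'"
    \<comment> \<open>A functor preserves inverse pairs, so the image of \<open>i\<close> is an
      isomorphism and the closure of \<open>Es k\<close> applies.\<close>
    have "arr_map (U k) (i \<cdot>\<^bsub>A\<^esub> e) \<in> Es k" if k: "k \<in> I" for k
    proof -
      interpret U: cat_functor A "Cs k" "U k" using U[OF k] .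
      interpret S: orth_fact_system "Cs k" "Es k" "Ms k" using S[OF k] .
      have "b \<in> Obj A" "b' \<in> Obj A" using i Dom_in_Obj Cod_in_Obj by (auto simp: hom_def)
      then show ?thesis
        using S.left_comp_iso[OF _ U.arr_map_hom[OF e(2)] U.arr_map_hom[OF i] U.arr_map_hom[OF j]]
          e(1) k ij U.arr_map_Comp[OF i j] U.arr_map_Comp[OF j i] U.arr_map_Comp[OF e(2) i]
        by (simp add: EA U.arr_map_Ident)
    qed
    then show "i \<cdot>\<^bsub>A\<^esub> e \<in> EA" using Comp_in_hom[OF e(2) i] by (simp add: EA homD(1))
  next
    fix m c c' d i j
    assume m: "m \<in> MA" "m \<in> hom A c d" and i: "i \<in> hom A c' c" and j: "j \<in> hom A c c'"
      and ij: "j \<cdot>\<^bsub>A\<^esub> i = Ident A c'" "i \<cdot>\<^bsub>A\<^esub> j = Ident A c"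
    have "arr_map (U k) (m \<cdot>\<^bsub>A\<^esub> i) \<in> Ms k" if k: "k \<in> I" for k
    proof -
      interpret U: cat_functor A "Cs k" "U k" using U[OF k] .
      interpret S: orth_fact_system "Cs k" "Es k" "Ms k" using S[OF k] .
      have "c \<in> Obj A" "c' \<in> Obj A" using i Dom_in_Obj Cod_in_Obj by (auto simp: hom_def)
      then show ?thesis
        using S.right_comp_iso[OF _ U.arr_map_hom[OF m(2)] U.arr_map_hom[OF i] U.arr_map_hom[OF j]]
          m(1) k ij U.arr_map_Comp[OF i j] U.arr_map_Comp[OF j i] U.arr_map_Comp[OF i m(2)]
        by (simp add: MA U.arr_map_Ident)
    qed
    then show "m \<cdot>\<^bsub>A\<^esub> i \<in> MA" using Comp_in_hom[OF i m(2)] by (simp add: MA homD(1))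
  qed (auto simp: EA MA)
  show ?thesis
  proof
    assume L: ?L
    then interpret EM: orth_fact_system A E M by blast
    have pres: "ofs_preserving_functor A E M (Cs i) (Es i) (Ms i) (U i)" if "i \<in> I" for i
      using L that by blast
    \<comment> \<open>Preservation says exactly that \<open>E\<close> and \<open>M\<close> lie in
      the joint preimages; these inclusions already force equality.\<close>
    have "E \<subseteq> EA" "M \<subseteq> MA"
      using EM.left_Arr EM.right_Arr ofs_preserving_functor.preserves_left[OF pres]
        ofs_preserving_functor.preserves_right[OF pres] by (auto simp: EA MA image_subset_iff)
    then show ?R by (rule EM.classes_eqI[OF ofs])
  next
    assume ?R
    then show ?L
      using ofs U by (auto simp: ofs_preserving_functor_def ofs_preserving_functor_axioms_def EA MA)
  qed
qed

text \<open>The case of a family with one member.\<close>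

lemma preimage_ofs_unique:
  assumes "cat_functor A C U" and "orth_fact_system C E' M'"
    and "\<And>f. f \<in> Arr A \<Longrightarrow> \<exists>e\<in>preimage_class A U E'. \<exists>m\<in>preimage_class A U M'.
      Cod A e = Dom A m \<and> f = m \<cdot>\<^bsub>A\<^esub> e"
    and "\<And>e m. e \<in> preimage_class A U E' \<Longrightarrow> m \<in> preimage_class A U M' \<Longrightarrow> orthogonal A e m"
  shows "orth_fact_system A E M \<and> ofs_preserving_functor A E M C E' M' U
    \<longleftrightarrow> E = preimage_class A U E' \<and> M = preimage_class A U M'"
proof -
  have "category A" using assms(1) by (simp add: cat_functor_def)
  from joint_preimage_ofs_unique[where I = "{()}" and A = A and U = "\<lambda>_. U" and Cs = "\<lambda>_. C"
      and Es = "\<lambda>_. E'" and Ms = "\<lambda>_. M'", OF this assms(1,2) _ _ assms(3,4)]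
  show ?thesis by (simp add: preimage_class_def)
qed

section \<open>Products\<close>

text \<open>\<open>Dom\<close> and \<open>Cod\<close> of the product return functions restricted to
  \<open>I\<close>, so a hom-set is empty unless both of its endpoints are extensional.\<close>

lemma hom_product_cat:
  "f \<in> hom (product_cat I C) a b \<longleftrightarrow>
    a \<in> extensional I \<and> b \<in> extensional I \<and> f \<in> (\<Pi>\<^sub>E i\<in>I. hom (C i) (a i) (b i))"
  by (auto simp: hom_def product_cat_def PiE_iff extensional_def fun_eq_iff restrict_def)

lemma hom_product_cat_component: "f \<in> hom (product_cat I C) a b \<Longrightarrow> i \<in> I \<Longrightarrow> f i \<in> hom (C i) (a i) (b i)"
  by (auto simp: hom_product_cat PiE_iff)

lemma product_cat_Comp: "g \<cdot>\<^bsub>product_cat I C\<^esub> f = (\<lambda>i\<in>I. g i \<cdot>\<^bsub>C i\<^esub> f i)"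
  by (simp add: product_cat_def)

text \<open>Factorizations and diagonals are chosen in each component; composition and equality of
  arrows are componentwise on \<open>I\<close>.\<close>

lemma product_ofs_unique:
  fixes I :: "'i set" and Cs :: "'i \<Rightarrow> ('p, 'q) cat"
  assumes S: "\<And>i. i \<in> I \<Longrightarrow> orth_fact_system (Cs i) (Es i) (Ms i)"
  shows "orth_fact_system (product_cat I Cs) E M \<and>
      (\<forall>i\<in>I. ofs_preserving_functor (product_cat I Cs) E M (Cs i) (Es i) (Ms i) (projection i))
    \<longleftrightarrow> E = product_class I Cs Es \<and> M = product_class I Cs Ms"
proof (rule joint_preimage_ofs_unique[OF _ _ S])
  have cat: "category (Cs i)" if "i \<in> I" for i
    using S[OF that] by (simp add: orth_fact_system_def)
  show P: "category (product_cat I Cs)" using cat by (rule category_product_cat)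
  then interpret P: category "product_cat I Cs" .
  show "cat_functor (product_cat I Cs) (Cs i) (projection i)" if "i \<in> I" for i
    using cat that by (rule cat_functor_projection)
  show "product_class I Cs Es =
      {f \<in> Arr (product_cat I Cs). \<forall>i\<in>I. arr_map (projection i) f \<in> Es i}"
    and "product_class I Cs Ms =
      {f \<in> Arr (product_cat I Cs). \<forall>i\<in>I. arr_map (projection i) f \<in> Ms i}"
    by (simp_all add: product_class_def projection_def)
  show "\<exists>e\<in>product_class I Cs Es. \<exists>m\<in>product_class I Cs Ms.
      Cod (product_cat I Cs) e = Dom (product_cat I Cs) m \<and> f = m \<cdot>\<^bsub>product_cat I Cs\<^esub> e"
    if f: "f \<in> Arr (product_cat I Cs)" for f
  proof -
    have "\<exists>e m. e \<in> Es i \<and> m \<in> Ms i \<and> Cod (Cs i) e = Dom (Cs i) m \<and> f i = m \<cdot>\<^bsub>Cs i\<^esub> e"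
      if i: "i \<in> I" for i
      using orth_fact_system.factorization[OF S[OF i], of "f i"] f i
      by (auto simp: product_cat_def)
    then obtain e m where em: "\<And>i. i \<in> I \<Longrightarrow> e i \<in> Es i \<and> m i \<in> Ms i \<and>
        Cod (Cs i) (e i) = Dom (Cs i) (m i) \<and> f i = m i \<cdot>\<^bsub>Cs i\<^esub> e i"
      by metis
    \<comment> \<open>The chosen families are arbitrary outside \<open>I\<close>; restricting them
      makes them extensional, as arrows of the product must be.\<close>
    have "restrict e I \<in> product_class I Cs Es" "restrict m I \<in> product_class I Cs Ms"
      using em orth_fact_system.left_Arr[OF S] orth_fact_system.right_Arr[OF S]
      by (auto simp: product_class_def product_cat_def)
    moreover have "Cod (product_cat I Cs) (restrict e I) = Dom (product_cat I Cs) (restrict m I)"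
      using em by (auto simp: product_cat_def)
    moreover have "f = restrict m I \<cdot>\<^bsub>product_cat I Cs\<^esub> restrict e I"
      using em f by (auto simp: product_cat_def PiE_iff extensional_def fun_eq_iff)
    ultimately show ?thesis by blast
  qed
  show "orthogonal (product_cat I Cs) e m"
    if e: "e \<in> product_class I Cs Es" and m: "m \<in> product_class I Cs Ms" for e m
  proof -
    obtain a b where e_hom: "e \<in> hom (product_cat I Cs) a b"
      using e Arr_in_hom by (force simp: product_class_def)
    obtain c d where m_hom: "m \<in> hom (product_cat I Cs) c d"
      using m Arr_in_hom by (force simp: product_class_def)
    note e_hom_i = hom_product_cat_component[OF e_hom]
    note m_hom_i = hom_product_cat_component[OF m_hom]
    have orth: "orthogonal (Cs i) (e i) (m i)" if "i \<in> I" for i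
      using orth_fact_system.orthogonal[OF S[OF that]] e m that by (simp add: product_class_def)
    have Comp_eq: "(g \<cdot>\<^bsub>product_cat I Cs\<^esub> f = g' \<cdot>\<^bsub>product_cat I Cs\<^esub> f') \<longleftrightarrow>
        (\<forall>i\<in>I. g i \<cdot>\<^bsub>Cs i\<^esub> f i = g' i \<cdot>\<^bsub>Cs i\<^esub> f' i)" for g f g' f'
      by (auto simp: product_cat_Comp fun_eq_iff restrict_def)
    show ?thesis
    proof (rule P.orthogonalI[OF e_hom m_hom])
      fix f g
      assume f: "f \<in> hom (product_cat I Cs) a c" and g: "g \<in> hom (product_cat I Cs) b d"
        and sq: "m \<cdot>\<^bsub>product_cat I Cs\<^esub> f = g \<cdot>\<^bsub>product_cat I Cs\<^esub> e"
      have "\<exists>h. h \<in> hom (Cs i) (b i) (c i) \<and> h \<cdot>\<^bsub>Cs i\<^esub> e i = f i \<and> m i \<cdot>\<^bsub>Cs i\<^esub> h = g i"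
        if i: "i \<in> I" for i
        using orthogonal_lift[OF orth[OF i] e_hom_i[OF i] m_hom_i[OF i]
            hom_product_cat_component[OF f i] hom_product_cat_component[OF g i]]
          i sq[unfolded Comp_eq] by metis
      then obtain h where h: "\<And>i. i \<in> I \<Longrightarrow>
          h i \<in> hom (Cs i) (b i) (c i) \<and> h i \<cdot>\<^bsub>Cs i\<^esub> e i = f i \<and> m i \<cdot>\<^bsub>Cs i\<^esub> h i = g i"
        by metis
      have "restrict h I \<in> hom (product_cat I Cs) b c"
        using h e_hom m_hom by (auto simp: hom_product_cat)
      moreover have "restrict h I \<cdot>\<^bsub>product_cat I Cs\<^esub> e = f" "m \<cdot>\<^bsub>product_cat I Cs\<^esub> restrict h I = g"
        using h f g by (auto simp: hom_product_cat product_cat_Comp PiE_iff extensional_def fun_eq_iff)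
      ultimately show "\<exists>h \<in> hom (product_cat I Cs) b c.
          h \<cdot>\<^bsub>product_cat I Cs\<^esub> e = f \<and> m \<cdot>\<^bsub>product_cat I Cs\<^esub> h = g" by blast
    next
      fix h k
      assume h: "h \<in> hom (product_cat I Cs) b c" and k: "k \<in> hom (product_cat I Cs) b c"
        and eqs: "h \<cdot>\<^bsub>product_cat I Cs\<^esub> e = k \<cdot>\<^bsub>product_cat I Cs\<^esub> e"
          "m \<cdot>\<^bsub>product_cat I Cs\<^esub> h = m \<cdot>\<^bsub>product_cat I Cs\<^esub> k"
      have "h i = k i" if i: "i \<in> I" for i
        by (rule category.orthogonal_lift_unique[OF cat[OF i] orth[OF i] e_hom_i[OF i] m_hom_i[OF i]])
          (use hom_product_cat_component[OF h i] hom_product_cat_component[OF k i]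
            i eqs[unfolded Comp_eq] in auto)
      then show "h = k" using h k by (auto simp: hom_product_cat intro: PiE_ext)
    qed
  qed
qed

section \<open>Inserters\<close>

lemma hom_inserter:
  "t \<in> hom (inserter C D F G) x y \<longleftrightarrow>
    (\<exists>f. t = (x, f, y) \<and> x \<in> inserter_obj C D F G \<and> y \<in> inserter_obj C D F G \<and>
      f \<in> hom C (fst x) (fst y) \<and> arr_map G f \<cdot>\<^bsub>D\<^esub> snd x = snd y \<cdot>\<^bsub>D\<^esub> arr_map F f)"
  by (cases x; cases y) (auto simp: hom_def inserter_def)

lemma inserter_Comp:
  "(y', g, z) \<cdot>\<^bsub>inserter C D F G\<^esub> (x, f, y) = (x, g \<cdot>\<^bsub>C\<^esub> f, z)"
  by (simp add: inserter_def)

lemma inserter_obj_hom: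
  "(c, \<phi>) \<in> inserter_obj C D F G \<longleftrightarrow> c \<in> Obj C \<and> \<phi> \<in> hom D (obj_map F c) (obj_map G c)"
  by (simp add: inserter_obj_def)

lemma preimage_class_inserter_forget:
  assumes "t \<in> preimage_class (inserter C D F G) inserter_forget E"
  obtains c \<phi> f d \<psi> where "t = ((c, \<phi>), f, (d, \<psi>))" "f \<in> hom C c d" "f \<in> E"
    "t \<in> hom (inserter C D F G) (c, \<phi>) (d, \<psi>)"
proof -
  have t: "t \<in> Arr (inserter C D F G)" "arr_map inserter_forget t \<in> E"
    using assms by (simp_all add: preimage_class_def)
  then obtain c \<phi> f d \<psi> where "t = ((c, \<phi>), f, (d, \<psi>))" "f \<in> hom C c d"
    by (auto simp: inserter_def)
  moreover from this have "f \<in> E" "t \<in> hom (inserter C D F G) (c, \<phi>) (d, \<psi>)"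
    using t by (simp_all add: inserter_forget_def inserter_def hom_def)
  ultimately show thesis by (rule that)
qed

text \<open>Existence of diagonals in \<open>D\<close> gives the factorizations, and their
  uniqueness shows that diagonals found in \<open>C\<close> are arrows of the inserter.\<close>

lemma inserter_ofs_unique:
  assumes ofsC: "orth_fact_system C E' M'" and ofsD: "orth_fact_system D E'' M''"
    and F: "cat_functor C D F" "arr_map F ` E' \<subseteq> E''"
    and G: "cat_functor C D G" "arr_map G ` M' \<subseteq> M''"
  shows "orth_fact_system (inserter C D F G) E M \<and>
      ofs_preserving_functor (inserter C D F G) E M C E' M' inserter_forget
    \<longleftrightarrow> E = preimage_class (inserter C D F G) inserter_forget E' \<and>
        M = preimage_class (inserter C D F G) inserter_forget M'"
proof (rule preimage_ofs_unique[OF cat_functor_inserter_forget[OF F(1) G(1)] ofsC])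
  interpret C: orth_fact_system C E' M' by fact
  interpret D: orth_fact_system D E'' M'' by fact
  interpret F: cat_functor C D F by fact
  interpret G: cat_functor C D G by fact
  interpret I: category "inserter C D F G" by (rule category_inserter[OF F(1) G(1)])
  \<comment> \<open>The only use of the two preservation hypotheses: \<open>F\<close> acts on the
    left arrow and \<open>G\<close> on the right one.\<close>
  have FG_orth: "orthogonal D (arr_map F e) (arr_map G m)" if "e \<in> E'" "m \<in> M'" for e m
    using D.orthogonal F(2) G(2) that by blast
  show "\<exists>e\<in>preimage_class (inserter C D F G) inserter_forget E'.
      \<exists>m\<in>preimage_class (inserter C D F G) inserter_forget M'.
        Cod (inserter C D F G) e = Dom (inserter C D F G) m \<and> t = m \<cdot>\<^bsub>inserter C D F G\<^esub> e"
    if "t \<in> Arr (inserter C D F G)" for t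
  proof -
    from that obtain c \<phi> f d \<psi> where t: "t = ((c, \<phi>), f, (d, \<psi>))"
      and cd: "(c, \<phi>) \<in> inserter_obj C D F G" "(d, \<psi>) \<in> inserter_obj C D F G"
      and f: "f \<in> hom C c d" and sq: "arr_map G f \<cdot>\<^bsub>D\<^esub> \<phi> = \<psi> \<cdot>\<^bsub>D\<^esub> arr_map F f"
      by (auto simp: inserter_def)
    have \<phi>: "\<phi> \<in> hom D (obj_map F c) (obj_map G c)" and \<psi>: "\<psi> \<in> hom D (obj_map F d) (obj_map G d)"
      using cd by (auto simp: inserter_obj_hom)
    obtain e m where em: "e \<in> E'" "m \<in> M'" "Cod C e = Dom C m" "f = m \<cdot>\<^bsub>C\<^esub> e"
      using C.factorization homD(1)[OF f] by blast
    define x where "x = Cod C e"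
    note Comp = C.Comp_Arr[OF C.left_Arr[OF em(1)] C.right_Arr[OF em(2)] em(3)]
    have e: "e \<in> hom C c x" and m: "m \<in> hom C x d"
      using em C.left_Arr C.right_Arr homD[OF f] homD[OF Comp] by (auto simp: hom_def x_def)
    note e_hom = F.arr_map_hom[OF e] G.arr_map_hom[OF e]
    note m_hom = F.arr_map_hom[OF m] G.arr_map_hom[OF m]
    \<comment> \<open>This is the compatibility of \<open>f\<close> with \<phi> and \<psi>, expanded
      along \<open>f = m \<cdot> e\<close> under both functors and read as a square from
      \<open>F e\<close> to \<open>G m\<close>.\<close>
    have "arr_map G m \<cdot>\<^bsub>D\<^esub> (arr_map G e \<cdot>\<^bsub>D\<^esub> \<phi>) = (\<psi> \<cdot>\<^bsub>D\<^esub> arr_map F m) \<cdot>\<^bsub>D\<^esub> arr_map F e"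
      using sq em(4) F.arr_map_Comp[OF e m] G.arr_map_Comp[OF e m]
        D.Comp_assoc[OF \<phi> e_hom(2) m_hom(2)] D.Comp_assoc[OF e_hom(1) m_hom(1) \<psi>] by simp
    \<comment> \<open>The diagonal is the structure morphism on the middle object \<open>x\<close>;
      its two equations say that \<open>e\<close> and \<open>m\<close> are arrows of the
      inserter.\<close>
    then obtain \<chi> where \<chi>: "\<chi> \<in> hom D (obj_map F x) (obj_map G x)"
      "\<chi> \<cdot>\<^bsub>D\<^esub> arr_map F e = arr_map G e \<cdot>\<^bsub>D\<^esub> \<phi>" "arr_map G m \<cdot>\<^bsub>D\<^esub> \<chi> = \<psi> \<cdot>\<^bsub>D\<^esub> arr_map F m"
      using orthogonal_lift[OF FG_orth[OF em(1,2)] e_hom(1) m_hom(2)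
          D.Comp_in_hom[OF \<phi> e_hom(2)] D.Comp_in_hom[OF m_hom(1) \<psi>]] by blast
    have x: "(x, \<chi>) \<in> inserter_obj C D F G"
      using \<chi>(1) C.Cod_in_Obj[OF C.left_Arr[OF em(1)]] by (simp add: inserter_obj_hom x_def)
    have "((c, \<phi>), e, (x, \<chi>)) \<in> preimage_class (inserter C D F G) inserter_forget E'"
      "((x, \<chi>), m, (d, \<psi>)) \<in> preimage_class (inserter C D F G) inserter_forget M'"
      using cd x e m em \<chi> by (auto simp: preimage_class_def inserter_def inserter_forget_def)
    moreover have "t = ((x, \<chi>), m, (d, \<psi>)) \<cdot>\<^bsub>inserter C D F G\<^esub> ((c, \<phi>), e, (x, \<chi>))"
      by (simp add: inserter_Comp t em(4))
    moreover have "Cod (inserter C D F G) ((c, \<phi>), e, (x, \<chi>)) =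
        Dom (inserter C D F G) ((x, \<chi>), m, (d, \<psi>))"
      by (simp add: inserter_def)
    ultimately show ?thesis by blast
  qed
  show "orthogonal (inserter C D F G) s t"
    if s: "s \<in> preimage_class (inserter C D F G) inserter_forget E'"
      and t: "t \<in> preimage_class (inserter C D F G) inserter_forget M'" for s t
  proof -
    obtain a \<alpha> e b \<beta> where s_eq: "s = ((a, \<alpha>), e, (b, \<beta>))" and e: "e \<in> hom C a b" and eE: "e \<in> E'"
      and s_hom: "s \<in> hom (inserter C D F G) (a, \<alpha>) (b, \<beta>)"
      using s by (rule preimage_class_inserter_forget)
    obtain c \<gamma> m d \<delta> where t_eq: "t = ((c, \<gamma>), m, (d, \<delta>))" and m: "m \<in> hom C c d" and mM: "m \<in> M'"
      and t_hom: "t \<in> hom (inserter C D F G) (c, \<gamma>) (d, \<delta>)"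
      using t by (rule preimage_class_inserter_forget)
    have e_sq: "arr_map G e \<cdot>\<^bsub>D\<^esub> \<alpha> = \<beta> \<cdot>\<^bsub>D\<^esub> arr_map F e"
      and m_sq: "arr_map G m \<cdot>\<^bsub>D\<^esub> \<gamma> = \<delta> \<cdot>\<^bsub>D\<^esub> arr_map F m"
      and \<alpha>: "\<alpha> \<in> hom D (obj_map F a) (obj_map G a)" and \<beta>: "\<beta> \<in> hom D (obj_map F b) (obj_map G b)"
      and \<gamma>: "\<gamma> \<in> hom D (obj_map F c) (obj_map G c)" and \<delta>: "\<delta> \<in> hom D (obj_map F d) (obj_map G d)"
      and objs: "(b, \<beta>) \<in> inserter_obj C D F G" "(c, \<gamma>) \<in> inserter_obj C D F G"
      using s_hom t_hom by (auto simp: hom_inserter s_eq t_eq inserter_obj_hom)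
    note e_hom = F.arr_map_hom[OF e] G.arr_map_hom[OF e]
    note m_hom = F.arr_map_hom[OF m] G.arr_map_hom[OF m]
    show ?thesis
    proof (rule I.orthogonalI[OF s_hom t_hom])
      fix p q
      assume "p \<in> hom (inserter C D F G) (a, \<alpha>) (c, \<gamma>)" "q \<in> hom (inserter C D F G) (b, \<beta>) (d, \<delta>)"
        and sq: "t \<cdot>\<^bsub>inserter C D F G\<^esub> p = q \<cdot>\<^bsub>inserter C D F G\<^esub> s"
      then obtain f g where p: "p = ((a, \<alpha>), f, (c, \<gamma>))" and q: "q = ((b, \<beta>), g, (d, \<delta>))"
        and f: "f \<in> hom C a c" and g: "g \<in> hom C b d"
        and f_sq: "arr_map G f \<cdot>\<^bsub>D\<^esub> \<alpha> = \<gamma> \<cdot>\<^bsub>D\<^esub> arr_map F f"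
        and g_sq: "arr_map G g \<cdot>\<^bsub>D\<^esub> \<beta> = \<delta> \<cdot>\<^bsub>D\<^esub> arr_map F g"
        by (auto simp: hom_inserter)
      have "m \<cdot>\<^bsub>C\<^esub> f = g \<cdot>\<^bsub>C\<^esub> e" using sq by (simp add: p q s_eq t_eq inserter_Comp)
      then obtain h where h: "h \<in> hom C b c" "h \<cdot>\<^bsub>C\<^esub> e = f" "m \<cdot>\<^bsub>C\<^esub> h = g"
        using orthogonal_lift[OF C.orthogonal[OF eE mM] e m f g] by blast
      note h_hom = F.arr_map_hom[OF h(1)] G.arr_map_hom[OF h(1)]
      \<comment> \<open>The diagonal \<open>h\<close> from \<open>C\<close> must respect the
        structure morphisms. Both sides go from \<open>F b\<close> to \<open>G c\<close>, so it
        suffices to compare them along \<open>F e\<close> and \<open>G m\<close>.\<close>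
      have "arr_map G h \<cdot>\<^bsub>D\<^esub> \<beta> = \<gamma> \<cdot>\<^bsub>D\<^esub> arr_map F h"
      proof (rule D.orthogonal_lift_unique[OF FG_orth[OF eE mM] e_hom(1) m_hom(2)
            D.Comp_in_hom[OF \<beta> h_hom(2)] D.Comp_in_hom[OF h_hom(1) \<gamma>]])
        \<comment> \<open>Both sides equal \<open>\<gamma> \<cdot> F f\<close>, by the compatibility
          of \<open>e\<close> and of \<open>f\<close>.\<close>
        show "(arr_map G h \<cdot>\<^bsub>D\<^esub> \<beta>) \<cdot>\<^bsub>D\<^esub> arr_map F e = (\<gamma> \<cdot>\<^bsub>D\<^esub> arr_map F h) \<cdot>\<^bsub>D\<^esub> arr_map F e"
          using F.arr_map_Comp[OF e h(1)] G.arr_map_Comp[OF e h(1)] h(2) f_sq e_sq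
            D.Comp_assoc[OF e_hom(1) \<beta> h_hom(2)] D.Comp_assoc[OF e_hom(1) h_hom(1) \<gamma>]
            D.Comp_assoc[OF \<alpha> e_hom(2) h_hom(2)] by metis
        \<comment> \<open>Both sides equal \<open>\<delta> \<cdot> F g\<close>, by the compatibility
          of \<open>g\<close> and of \<open>m\<close>.\<close>
        show "arr_map G m \<cdot>\<^bsub>D\<^esub> (arr_map G h \<cdot>\<^bsub>D\<^esub> \<beta>) = arr_map G m \<cdot>\<^bsub>D\<^esub> (\<gamma> \<cdot>\<^bsub>D\<^esub> arr_map F h)"
          using F.arr_map_Comp[OF h(1) m] G.arr_map_Comp[OF h(1) m] h(3) g_sq m_sq
            D.Comp_assoc[OF \<beta> h_hom(2) m_hom(2)] D.Comp_assoc[OF h_hom(1) \<gamma> m_hom(2)]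
            D.Comp_assoc[OF h_hom(1) m_hom(1) \<delta>] by metis
      qed
      then have "((b, \<beta>), h, (c, \<gamma>)) \<in> hom (inserter C D F G) (b, \<beta>) (c, \<gamma>)"
        using h(1) objs by (simp add: hom_inserter)
      moreover have "((b, \<beta>), h, (c, \<gamma>)) \<cdot>\<^bsub>inserter C D F G\<^esub> s = p"
        "t \<cdot>\<^bsub>inserter C D F G\<^esub> ((b, \<beta>), h, (c, \<gamma>)) = q"
        by (simp_all add: s_eq t_eq p q inserter_Comp h)
      ultimately show "\<exists>k \<in> hom (inserter C D F G) (b, \<beta>) (c, \<gamma>).
          k \<cdot>\<^bsub>inserter C D F G\<^esub> s = p \<and> t \<cdot>\<^bsub>inserter C D F G\<^esub> k = q" by blast
    next
      fix p q
      assume "p \<in> hom (inserter C D F G) (b, \<beta>) (c, \<gamma>)" "q \<in> hom (inserter C D F G) (b, \<beta>) (c, \<gamma>)"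
        and "p \<cdot>\<^bsub>inserter C D F G\<^esub> s = q \<cdot>\<^bsub>inserter C D F G\<^esub> s"
          "t \<cdot>\<^bsub>inserter C D F G\<^esub> p = t \<cdot>\<^bsub>inserter C D F G\<^esub> q"
      \<comment> \<open>With fixed endpoints an arrow of the inserter is determined by its
        underlying arrow, so uniqueness descends from \<open>C\<close>.\<close>
      then show "p = q"
        using C.orthogonal_lift_unique[OF C.orthogonal[OF eE mM] e m]
        by (auto simp: hom_inserter s_eq t_eq inserter_Comp)
    qed
  qed
qed

section \<open>Full subcategories and equifiers\<close>

lemma hom_full_subcat: "f \<in> hom (full_subcat C S) a b \<longleftrightarrow> a \<in> S \<and> b \<in> S \<and> f \<in> hom C a b"
  by (auto simp: hom_def full_subcat_def)

lemma full_subcat_simps [simp]: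
  "Dom (full_subcat C S) = Dom C" "Cod (full_subcat C S) = Cod C"
  "Comp (full_subcat C S) = Comp C"
  by (simp_all add: full_subcat_def)

text \<open>A diagonal runs from \<open>Cod C e\<close> to \<open>Dom C m\<close>, both in
  \<open>S\<close>, so by fullness it is the same datum in either category.\<close>

lemma orthogonal_full_subcat:
  assumes "orthogonal C e m" "e \<in> Arr (full_subcat C S)" "m \<in> Arr (full_subcat C S)"
  shows "orthogonal (full_subcat C S) e m"
proof -
  have "Cod C e \<in> S" "Dom C m \<in> S" using assms(2,3) by (auto simp: full_subcat_def)
  then show ?thesis using assms(1) by (simp add: orthogonal_def hom_full_subcat)
qed

lemma preimage_class_inclusion: "preimage_class C inclusion E = Arr C \<inter> E"
  by (auto simp: preimage_class_def inclusion_def)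

text \<open>Orthogonality is inherited, so the one thing to secure is that factorizations stay
  inside; \<open>mid\<close> says that the middle object lies in \<open>S\<close> once both ends
  do.\<close>

lemma full_subcat_ofs_unique:
  assumes ofs: "orth_fact_system C E' M'"
    and mid: "\<And>e m. e \<in> E' \<Longrightarrow> m \<in> M' \<Longrightarrow> Cod C e = Dom C m \<Longrightarrow> Dom C e \<in> S \<Longrightarrow> Cod C m \<in> S \<Longrightarrow>
      Cod C e \<in> S"
  shows "orth_fact_system (full_subcat C S) E M \<and>
      ofs_preserving_functor (full_subcat C S) E M C E' M' inclusion
    \<longleftrightarrow> E = preimage_class (full_subcat C S) inclusion E' \<and>
        M = preimage_class (full_subcat C S) inclusion M'"
proof -
  interpret C: orth_fact_system C E' M' by fact
  show ?thesis
  proof (rule preimage_ofs_unique[OF cat_functor_inclusion[OF C.category_axioms] ofs];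
      unfold preimage_class_inclusion)
    fix f assume "f \<in> Arr (full_subcat C S)"
    then have f: "f \<in> Arr C" "Dom C f \<in> S" "Cod C f \<in> S" by (auto simp: full_subcat_def)
    obtain e m where em: "e \<in> E'" "m \<in> M'" "Cod C e = Dom C m" "f = m \<cdot>\<^bsub>C\<^esub> e"
      using C.factorization f(1) by blast
    have ends: "Dom C e \<in> S" "Cod C m \<in> S"
      using homD[OF C.Comp_Arr[OF C.left_Arr[OF em(1)] C.right_Arr[OF em(2)] em(3)]] em(4) f by auto
    have "e \<in> Arr (full_subcat C S) \<inter> E'" "m \<in> Arr (full_subcat C S) \<inter> M'"
      using em C.left_Arr C.right_Arr ends mid[OF em(1,2,3) ends] by (auto simp: full_subcat_def)
    then show "\<exists>e\<in>Arr (full_subcat C S) \<inter> E'. \<exists>m\<in>Arr (full_subcat C S) \<inter> M'.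
        Cod (full_subcat C S) e = Dom (full_subcat C S) m \<and> f = m \<cdot>\<^bsub>full_subcat C S\<^esub> e"
      using em by auto
  next
    fix e m
    assume "e \<in> Arr (full_subcat C S) \<inter> E'" "m \<in> Arr (full_subcat C S) \<inter> M'"
    then show "orthogonal (full_subcat C S) e m"
      by (intro orthogonal_full_subcat C.orthogonal) simp_all
  qed
qed

text \<open>The task is to show that \<eta> and \<theta> agree at the middle object of a
  factorization whose ends they agree on; uniqueness of diagonals between \<open>F e\<close> and
  \<open>G m\<close> does this.\<close>

lemma equifier_ofs_unique:
  assumes ofsC: "orth_fact_system C E' M'" and ofsD: "orth_fact_system D E'' M''"
    and F: "arr_map F ` E' \<subseteq> E''" and G: "arr_map G ` M' \<subseteq> M''"
    and \<eta>: "nat_transformation C D F G \<eta>" and \<theta>: "nat_transformation C D F G \<theta>"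
  shows "orth_fact_system (equifier C \<eta> \<theta>) E M \<and>
      ofs_preserving_functor (equifier C \<eta> \<theta>) E M C E' M' inclusion
    \<longleftrightarrow> E = preimage_class (equifier C \<eta> \<theta>) inclusion E' \<and>
        M = preimage_class (equifier C \<eta> \<theta>) inclusion M'"
  unfolding equifier_def
proof (rule full_subcat_ofs_unique[OF ofsC], unfold mem_Collect_eq)
  interpret C: orth_fact_system C E' M' by fact
  interpret D: orth_fact_system D E'' M'' by fact
  interpret \<eta>: nat_transformation C D F G \<eta> by fact
  interpret \<theta>: nat_transformation C D F G \<theta> by fact
  fix e m
  assume eE: "e \<in> E'" and mM: "m \<in> M'" and mid: "Cod C e = Dom C m"
    and eqs: "\<eta> (Dom C e) = \<theta> (Dom C e)" "\<eta> (Cod C m) = \<theta> (Cod C m)"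
  have e: "e \<in> hom C (Dom C e) (Cod C e)" and m: "m \<in> hom C (Cod C e) (Cod C m)"
    using Arr_in_hom[OF C.left_Arr[OF eE]] Arr_in_hom[OF C.right_Arr[OF mM]] mid by auto
  have x: "Cod C e \<in> Obj C" using C.Cod_in_Obj C.left_Arr eE by blast
  have "orthogonal D (arr_map F e) (arr_map G m)" using D.orthogonal F G eE mM by blast
  \<comment> \<open>Naturality along \<open>e\<close> reduces agreement after precomposing with
    \<open>F e\<close> to agreement at \<open>Dom C e\<close>; naturality along \<open>m\<close>
    reduces agreement after composing with \<open>G m\<close> to agreement at
    \<open>Cod C m\<close>.\<close>
  then show "\<eta> (Cod C e) = \<theta> (Cod C e)"
    by (rule D.orthogonal_lift_unique[OF _ \<eta>.F.arr_map_hom[OF e] \<eta>.G.arr_map_hom[OF m]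
          \<eta>.component_hom[OF x] \<theta>.component_hom[OF x]])
      (metis \<eta>.naturality \<theta>.naturality e m eqs)+
qed

text \<open>Each equivalence, quantified over all \<open>E\<close> and \<open>M\<close>, expresses
  existence from right to left and uniqueness from left to right.\<close>

theorem theorem5p3:
  fixes I :: "'i set"
    and Cs :: "'i \<Rightarrow> ('p, 'q) cat" and Es Ms :: "'i \<Rightarrow> 'q set"
    and C :: "('o1, 'a1) cat" and E' M' :: "'a1 set"
    and D :: "('o2, 'a2) cat" and E'' M'' :: "'a2 set"
    and F G :: "('o1, 'a1, 'o2, 'a2) func"
  assumes "\<And>i. i \<in> I \<Longrightarrow> orth_fact_system (Cs i) (Es i) (Ms i)"
    and "orth_fact_system C E' M'"
    and "orth_fact_system D E'' M''"
    and "cat_functor C D F" and "arr_map F ` E' \<subseteq> E''"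
    and "cat_functor C D G" and "arr_map G ` M' \<subseteq> M''"
  shows
    "(\<forall>E M. orth_fact_system (product_cat I Cs) E M \<and>
        (\<forall>i\<in>I. ofs_preserving_functor (product_cat I Cs) E M (Cs i) (Es i) (Ms i) (projection i))
      \<longleftrightarrow> E = product_class I Cs Es \<and> M = product_class I Cs Ms) \<and>
    (\<forall>E M. orth_fact_system (inserter C D F G) E M \<and>
        ofs_preserving_functor (inserter C D F G) E M C E' M' inserter_forget
      \<longleftrightarrow> E = preimage_class (inserter C D F G) inserter_forget E' \<and>
          M = preimage_class (inserter C D F G) inserter_forget M') \<and>
    (\<forall>\<eta> \<theta>. nat_transformation C D F G \<eta> \<and> nat_transformation C D F G \<theta> \<longrightarrow>
      (\<forall>E M. orth_fact_system (equifier C \<eta> \<theta>) E M \<and>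
          ofs_preserving_functor (equifier C \<eta> \<theta>) E M C E' M' inclusion
        \<longleftrightarrow> E = preimage_class (equifier C \<eta> \<theta>) inclusion E' \<and>
            M = preimage_class (equifier C \<eta> \<theta>) inclusion M'))"
proof (intro conjI allI impI, goal_cases)
  case (1 E M)
  show ?case using assms(1) by (rule product_ofs_unique)
next
  case (2 E M)
  show ?case using assms(2-7) by (rule inserter_ofs_unique)
next
  case (3 \<eta> \<theta> E M)
  then show ?case using equifier_ofs_unique[OF assms(2,3,5,7)] by simp
qed

end
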